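(* For all integers $d,r\ge 2$, it holds that $f^{\mathrm{top}}(d,r)\ge 1$ and $f^{\mathrm{Haar}}(d,r)\ge 1$. Also, for every odd integer $d\ge 3$, it holds that $f^{\mathrm{top}}(d,4)\ge 2$ and $f^{\mathrm{Haar}}(d,4)\ge 2$.
   Context: Let $d,r\ge 2$ be integers. $\mathrm{SO}(d)$ is the group of real special orthogonal $d\times d$ matrices, and $\mathbb{S}^{d-1}=\{x\in\mathbb{R}^d : \|x\|_2=1\}$ is the Euclidean unit sphere, on which $\gamma\in\mathrm{SO}(d)$ acts by matrix multiplication $x\mapsto \gamma x$. Let $\mu$ be the spherical measure on $\mathbb{S}^{d-1}$ (the $(d-1)$-dimensional Hausdorff measure with respect to geodesic distance); it is invariant under $\mathrm{SO}(d)$. The group acts on functions $f:\mathbb{S}^{d-1}\to\mathbb{R}$ by $(\gamma.f)(v):=f(\gamma^{-1}v)$, and this action preserves the real Hilbert space $L^2(\mathbb{S}^{d-1},\mu)$. An $r$-tuple $(\gamma_1,\ldots,\gamma_r)\in\mathrm{SO}(d)^r$ fractionally divides $\mathbb{S}^{d-1}$ if there is $f\in L^2(\mathbb{S}^{d-1},\mu)$ such that $\sum_{i=1}^r\gamma_i.f=1$ $\mu$-almost everywhere and $f$ differs from $1/r$ on a set of positive $\mu$-measure (equivalently, $f$ is not $\mu$-a.e. constant). Let $\mathcal{D}_{d,r}\subseteq\mathrm{SO}(d)^r$ be the set of all $r$-tuples that fractionally divide $\mathbb{S}^{d-1}$. For an integer $0\le \ell\le r$ and an $(r-\ell)$-tuple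 $\gamma'=(\gamma_{\ell+1},\ldots,\gamma_r)\in\mathrm{SO}(d)^{r-\ell}$, define the section $$\mathcal{D}_{d,r}(\gamma'):=\{(\gamma_1,\ldots,\gamma_\ell)\in\mathrm{SO}(d)^\ell : (\gamma_1,\ldots,\gamma_r)\in\mathcal{D}_{d,r}\}.$$ Then $f^{\mathrm{top}}(d,r)$ (resp. $f^{\mathrm{Haar}}(d,r)$) is the smallest integer $\ell$ with $0\le\ell\le r$ such that for every $\gamma'\in\mathrm{SO}(d)^{r-\ell}$ the section $\mathcal{D}_{d,r}(\gamma')$ is a meager (resp. Haar-null) subset of the compact group $\mathrm{SO}(d)^\ell$. (For $\ell=0$ the group $\mathrm{SO}(d)^0$ is the one-point group, whose only meager, resp. null, subset is the empty set.) It is known that $\mathcal{D}_{d,r}$ itself is both meager and null in $\mathrm{SO}(d)^r$, so both quantities are well defined and at most $r$. *)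

theory Defs
  imports "HOL-Probability.Probability"
begin

section \<open>Hausdorff measure and the spherical measure\<close>

definition diam_wrt :: "('a \<Rightarrow> 'a \<Rightarrow> real) \<Rightarrow> 'a set \<Rightarrow> ennreal" where
  "diam_wrt dst U = (SUP x\<in>U. SUP y\<in>U. ennreal (dst x y))"

text \<open>
  The \<open>s\<close>-dimensional Hausdorff outer measure of a metric space with carrier \<open>X\<close> and distance
  \<open>dst\<close>, for an integer \<open>s \<ge> 1\<close>.  The factor \<open>unit_ball_vol s / 2 ^ s\<close> is the usual normalisation,
  under which the measure on the unit sphere is surface area.
\<close>

definition hausdorff_premeasure ::
    "('a \<Rightarrow> 'a \<Rightarrow> real) \<Rightarrow> 'a set \<Rightarrow> nat \<Rightarrow> real \<Rightarrow> 'a set \<Rightarrow> ennreal" where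
  "hausdorff_premeasure dst X s \<delta> A =
     (INF U \<in> {U :: nat \<Rightarrow> 'a set. (\<forall>i. U i \<subseteq> X \<and> diam_wrt dst (U i) \<le> ennreal \<delta>) \<and> A \<subseteq> (\<Union>i. U i)}.
        \<Sum>i. ennreal (unit_ball_vol (real s) / 2 ^ s) * diam_wrt dst (U i) ^ s)"

definition hausdorff_outer_measure ::
    "('a \<Rightarrow> 'a \<Rightarrow> real) \<Rightarrow> 'a set \<Rightarrow> nat \<Rightarrow> 'a set \<Rightarrow> ennreal" where
  "hausdorff_outer_measure dst X s A = (SUP \<delta>\<in>{0<..}. hausdorff_premeasure dst X s \<delta> A)"

text \<open>Geodesic distance between two points of the Euclidean unit sphere.\<close>

definition geodesic_dist :: "real^'d \<Rightarrow> real^'d \<Rightarrow> real" where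
  "geodesic_dist x y = arccos (x \<bullet> y)"

text \<open>
  Borel sets are measurable for the Hausdorff outer measure (a metric outer measure), so
  \<open>measure_of\<close> does not fall back to the zero measure here.
\<close>

definition sphere_measure :: "(real^'d) measure" where
  "sphere_measure =
     measure_of (sphere 0 1) (sets (restrict_space borel (sphere 0 1)))
       (hausdorff_outer_measure geodesic_dist (sphere 0 1) (CARD('d) - 1))"

definition real_L2 :: "'a measure \<Rightarrow> ('a \<Rightarrow> real) set" where
  "real_L2 M = {f \<in> borel_measurable M. integrable M (\<lambda>x. (f x)\<^sup>2)}"


section \<open>Fractional division of the sphere\<close>

definition SO :: "(real^'d^'d) set" where
  "SO = {A. rotation_matrix A}"

definition act :: "real^'d^'d \<Rightarrow> (real^'d \<Rightarrow> real) \<Rightarrow> (real^'d \<Rightarrow> real)" where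
  "act \<gamma> f = (\<lambda>v. f (matrix_inv \<gamma> *v v))"

definition fractionally_divides :: "nat \<Rightarrow> (nat \<Rightarrow> real^'d^'d) \<Rightarrow> bool" where
  "fractionally_divides r \<gamma> \<longleftrightarrow>
     (\<exists>f \<in> real_L2 (sphere_measure :: (real^'d) measure).
        (AE v in sphere_measure. (\<Sum>i=1..r. act (\<gamma> i) f v) = 1) \<and>
        emeasure sphere_measure {v \<in> space sphere_measure. f v \<noteq> 1 / real r} > 0)"

text \<open>
  A tuple with indices in \<open>I\<close> is an extensional function on \<open>I\<close>; for \<open>I = {}\<close> there is exactly one.
\<close>

definition SO_tuples :: "nat set \<Rightarrow> (nat \<Rightarrow> real^'d^'d) set" where
  "SO_tuples I = (\<Pi>\<^sub>E i\<in>I. SO)"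

definition dividing_tuples :: "nat \<Rightarrow> (nat \<Rightarrow> real^'d^'d) set" where
  "dividing_tuples r = {\<gamma> \<in> SO_tuples {1..r}. fractionally_divides r \<gamma>}"

definition dividing_section ::
    "nat \<Rightarrow> nat \<Rightarrow> (nat \<Rightarrow> real^'d^'d) \<Rightarrow> (nat \<Rightarrow> real^'d^'d) set" where
  "dividing_section r l \<gamma>' =
     {\<gamma> \<in> SO_tuples {1..l}. merge {1..l} {l+1..r} (\<gamma>, \<gamma>') \<in> dividing_tuples r}"


section \<open>Meager and Haar-null sets\<close>

definition nowhere_dense_in :: "'a topology \<Rightarrow> 'a set \<Rightarrow> bool" where
  "nowhere_dense_in X A \<longleftrightarrow> A \<subseteq> topspace X \<and> X interior_of (X closure_of A) = {}"

definition meager_in :: "'a topology \<Rightarrow> 'a set \<Rightarrow> bool" where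
  "meager_in X A \<longleftrightarrow> (\<exists>N :: nat \<Rightarrow> 'a set. (\<forall>n. nowhere_dense_in X (N n)) \<and> A = (\<Union>n. N n))"

text \<open>
  Normalised Haar measure of a compact group, given by its topology (whose \<open>topspace\<close> is the
  carrier) and its multiplication.
\<close>

definition haar_prob_measure :: "'a topology \<Rightarrow> ('a \<Rightarrow> 'a \<Rightarrow> 'a) \<Rightarrow> 'a measure \<Rightarrow> bool" where
  "haar_prob_measure X mlt M \<longleftrightarrow>
     prob_space M \<and> space M = topspace X \<and>
     sets M = sigma_sets (topspace X) {U. openin X U} \<and>
     (\<forall>g \<in> topspace X. \<forall>A \<in> sets M. mlt g ` A \<in> sets M \<and> emeasure M (mlt g ` A) = emeasure M A)"

text \<open>
  Null with respect to (the completion of) Haar measure.  On a compact metrizable group the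
  measure \<open>M\<close> below exists and is unique, so the existential quantifier just names it.
\<close>

definition haar_null_in :: "'a topology \<Rightarrow> ('a \<Rightarrow> 'a \<Rightarrow> 'a) \<Rightarrow> 'a set \<Rightarrow> bool" where
  "haar_null_in X mlt A \<longleftrightarrow> (\<exists>M. haar_prob_measure X mlt M \<and> (\<exists>N \<in> null_sets M. A \<subseteq> N))"

definition SO_power_topology :: "nat \<Rightarrow> (nat \<Rightarrow> real^'d^'d) topology" where
  "SO_power_topology l = product_topology (\<lambda>_. top_of_set SO) {1..l}"

definition SO_power_mult ::
    "nat \<Rightarrow> (nat \<Rightarrow> real^'d^'d) \<Rightarrow> (nat \<Rightarrow> real^'d^'d) \<Rightarrow> (nat \<Rightarrow> real^'d^'d)" where
  "SO_power_mult l g h = (\<lambda>i\<in>{1..l}. g i ** h i)"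


section \<open>The two invariants\<close>

text \<open>
  The dimension is \<open>d = CARD('d)\<close>, passed as a type argument.  The infimum in \<open>enat\<close> is the least
  element of the set of admissible \<open>l\<close> whenever that set is nonempty; for \<open>d, r \<ge> 2\<close> it always
  contains \<open>r\<close>, since the set of all dividing tuples is meager and Haar-null.
\<close>

definition f_top :: "'d::finite itself \<Rightarrow> nat \<Rightarrow> enat" where
  "f_top _ r = (INF l \<in> {l. l \<le> r \<and>
      (\<forall>\<gamma>' \<in> SO_tuples {l+1..r}.
         meager_in (SO_power_topology l)
           (dividing_section r l \<gamma>' :: (nat \<Rightarrow> real^'d^'d) set))}. enat l)"

definition f_Haar :: "'d::finite itself \<Rightarrow> nat \<Rightarrow> enat" where
  "f_Haar _ r = (INF l \<in> {l. l \<le> r \<and>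
      (\<forall>\<gamma>' \<in> SO_tuples {l+1..r}.
         haar_null_in (SO_power_topology l) (SO_power_mult l)
           (dividing_section r l \<gamma>' :: (nat \<Rightarrow> real^'d^'d) set))}. enat l)"

end

theory Submission
  imports Defs
begin

text \<open>
  If \<open>w \<noteq> 0\<close> and the rotations \<open>\<gamma>\<^sub>1, \<dots>, \<gamma>\<^sub>r\<close> satisfy \<open>\<gamma>\<^sub>1 w + \<dots> + \<gamma>\<^sub>r w = 0\<close>, then the affine function
  \<open>v \<mapsto> 1/r + w \<bullet> v\<close> shows that they divide the sphere: its translates sum to \<open>1\<close> everywhere, and it
  is not constant (\<open>fractionally_divides_if_images_sum_zero\<close>).

  For \<open>l = 0\<close> one tuple of this kind suffices.  Rotations that carry a unit vector \<open>w\<close> to the \<open>r\<close>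
  vertices of a regular \<open>r\<close>-gon in a plane form one (\<open>roots_of_unity_tuple\<close>; for \<open>r = 2\<close> the two
  vertices are antipodal).

  For \<open>d\<close> odd, \<open>r = 4\<close> and \<open>l = 1\<close>, there are three diagonal sign matrices in \<open>SO d\<close> with sum \<open>-1\<close>
  (\<open>three_sign_matrices\<close>).  Together with any fourth rotation \<open>\<gamma>\<^sub>1\<close> they have sum \<open>\<gamma>\<^sub>1 - 1\<close>, which is
  singular because a rotation in odd dimension fixes a nonzero vector
  (\<open>odd_rotation_fixed_vector\<close>).  Hence the section over these three matrices is all of \<open>SO d\<close>.  The
  full group is not meager by Baire's theorem, and it is not a null set of a probability measure.

  Most of the work goes into the spherical measure.  The Hausdorff outer measure has to be shown
  countably additive on Borel sets (\<open>measure_space_metric_outer_measure\<close>, Caratheodory's criterion),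
  finite on the sphere so that bounded functions are square integrable
  (\<open>hausdorff_outer_measure_sphere_finite\<close>), and positive where the affine function is not equal to
  \<open>1/r\<close> (\<open>hausdorff_outer_measure_axis_neighbourhood_pos\<close>).
\<close>

section \<open>Hausdorff outer measures\<close>

lemma hausdorff_premeasure_le:
  assumes "\<And>i. U i \<subseteq> X" "\<And>i. diam_wrt dst (U i) \<le> ennreal \<delta>" "A \<subseteq> (\<Union>i. U i)"
  shows "hausdorff_premeasure dst X s \<delta> A
    \<le> (\<Sum>i. ennreal (unit_ball_vol (real s) / 2 ^ s) * diam_wrt dst (U i) ^ s)"
  unfolding hausdorff_premeasure_def using assms by (intro INF_lower) auto

lemma hausdorff_premeasure_mono:
  assumes "A \<subseteq> B"
  shows "hausdorff_premeasure dst X s \<delta> A \<le> hausdorff_premeasure dst X s \<delta> B"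
  unfolding hausdorff_premeasure_def using assms by (intro INF_superset_mono) auto

lemma hausdorff_premeasure_antimono:
  assumes "\<delta> \<le> \<delta>'"
  shows "hausdorff_premeasure dst X s \<delta>' A \<le> hausdorff_premeasure dst X s \<delta> A"
  unfolding hausdorff_premeasure_def
  using ennreal_leI[OF assms] by (intro INF_superset_mono) (auto intro: order_trans)

lemma hausdorff_premeasure_le_outer_measure:
  "0 < \<delta> \<Longrightarrow> hausdorff_premeasure dst X s \<delta> A \<le> hausdorff_outer_measure dst X s A"
  unfolding hausdorff_outer_measure_def by (intro SUP_upper) auto

lemma diam_wrt_empty [simp]: "diam_wrt dst {} = 0"
  by (simp add: diam_wrt_def bot_ennreal)

lemma le_diam_wrt: "x \<in> U \<Longrightarrow> y \<in> U \<Longrightarrow> ennreal (dst x y) \<le> diam_wrt dst U"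
  unfolding diam_wrt_def by (meson SUP_upper2 order_refl)

text \<open>
  Positivity of \<open>s\<close> matters: \<open>0 ^ 0 = 1\<close> would charge even the empty set.
\<close>

lemma hausdorff_premeasure_empty:
  assumes "0 < s"
  shows "hausdorff_premeasure dst X s \<delta> {} = 0"
proof -
  have "hausdorff_premeasure dst X s \<delta> {}
      \<le> (\<Sum>i::nat. ennreal (unit_ball_vol (real s) / 2 ^ s) * diam_wrt dst {} ^ s)"
    by (rule hausdorff_premeasure_le) auto
  then show ?thesis using assms by (simp add: zero_power)
qed

text \<open>
  The usual \<open>\<epsilon>/2\<^sup>n\<close> argument: near-optimal covers of the \<open>A n\<close>, listed along a bijection
  \<open>nat \<times> nat \<rightarrow> nat\<close>, form one countable cover of the union.
\<close>

lemma hausdorff_premeasure_UN_le: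
  "hausdorff_premeasure dst X s \<delta> (\<Union>n. A n) \<le> (\<Sum>n. hausdorff_premeasure dst X s \<delta> (A n))"
proof (rule ennreal_le_epsilon)
  let ?P = "hausdorff_premeasure dst X s \<delta>"
  let ?w = "\<lambda>V. ennreal (unit_ball_vol (real s) / 2 ^ s) * diam_wrt dst V ^ s"
  fix e :: real assume "0 < e" "(\<Sum>n. ?P (A n)) < top"
  then have *: "?P (A n) < ?P (A n) + e * (1/2)^Suc n" for n
    by (auto simp add: less_top dest!: ennreal_suminf_lessD)
  have "\<exists>U. (\<forall>i. U i \<subseteq> X \<and> diam_wrt dst (U i) \<le> ennreal \<delta>) \<and> A n \<subseteq> (\<Union>i. U i) \<and>
      (\<Sum>i. ?w (U i)) < ?P (A n) + e * (1/2)^Suc n" for n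
    using *[of n] unfolding hausdorff_premeasure_def INF_less_iff by auto
  then obtain U where U: "\<And>n i. U n i \<subseteq> X" "\<And>n i. diam_wrt dst (U n i) \<le> ennreal \<delta>"
    "\<And>n. A n \<subseteq> (\<Union>i. U n i)" "\<And>n. (\<Sum>i. ?w (U n i)) < ?P (A n) + e * (1/2)^Suc n"
    by metis
  define C where "C = case_prod U \<circ> prod_decode"
  have "?P (\<Union>n. A n) \<le> (\<Sum>i. ?w (C i))"
  proof (rule hausdorff_premeasure_le)
    show "(\<Union>n. A n) \<subseteq> (\<Union>i. C i)"
      using U(3) by (auto simp add: C_def subset_eq) (metis prod.case prod_encode_inverse)
  qed (use U in \<open>auto simp: C_def split_def\<close>)
  also have "\<dots> = (\<Sum>n. \<Sum>i. ?w (U n i))"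
    unfolding C_def comp_def
    using suminf_ennreal_2dimen[of "\<lambda>n. \<Sum>i. ?w (U n i)" "\<lambda>p. ?w (case_prod U p)"] by simp
  also have "\<dots> \<le> (\<Sum>n. ?P (A n) + e * (1/2) ^ Suc n)"
    using U(4) by (intro suminf_le allI less_imp_le) auto
  also have "\<dots> = (\<Sum>n. ?P (A n)) + (\<Sum>n. ennreal e * ennreal ((1/2) ^ Suc n))"
    using \<open>0 < e\<close> by (subst suminf_add[symmetric])
      (auto simp del: ennreal_suminf_cmult simp add: ennreal_mult[symmetric])
  also have "\<dots> = (\<Sum>n. ?P (A n)) + e"
    unfolding ennreal_suminf_cmult
    by (subst suminf_ennreal_eq[OF zero_le_power power_half_series]) auto
  finally show "?P (\<Union>n. A n) \<le> (\<Sum>n. ?P (A n)) + e" .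
qed

lemma outer_measure_space_hausdorff:
  assumes "0 < s"
  shows "outer_measure_space (Pow X) (hausdorff_outer_measure dst X s)"
  unfolding outer_measure_space_def
proof (intro conjI)
  let ?H = "hausdorff_outer_measure dst X s"
  show "positive (Pow X) ?H"
    using hausdorff_premeasure_empty[OF assms, of dst X]
    by (auto simp: positive_def hausdorff_outer_measure_def)
  show "increasing (Pow X) ?H"
    unfolding increasing_def hausdorff_outer_measure_def
    by (intro ballI impI SUP_mono') (auto intro: hausdorff_premeasure_mono)
  show "countably_subadditive (Pow X) ?H"
    unfolding countably_subadditive_def
  proof (intro allI impI)
    fix A :: "nat \<Rightarrow> 'a set"
    show "?H (\<Union>n. A n) \<le> (\<Sum>n. ?H (A n))"
      unfolding hausdorff_outer_measure_def[of _ _ _ "\<Union>n. A n"]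
    proof (rule SUP_least)
      fix \<delta> :: real assume "\<delta> \<in> {0<..}"
      then have "(\<Sum>n. hausdorff_premeasure dst X s \<delta> (A n)) \<le> (\<Sum>n. ?H (A n))"
        by (intro suminf_le) (auto intro: hausdorff_premeasure_le_outer_measure)
      then show "hausdorff_premeasure dst X s \<delta> (\<Union>n. A n) \<le> (\<Sum>n. ?H (A n))"
        using hausdorff_premeasure_UN_le order_trans by blast
    qed
  qed
qed

text \<open>
  A cover by pieces of diameter below the separation \<open>e\<close> splits: no piece meets both sets, so
  the pieces meeting \<open>A\<close> and those meeting \<open>B\<close> are paid for separately.
\<close>

lemma hausdorff_outer_measure_separated:
  assumes s: "0 < s" and e: "0 < e" and sep: "\<And>a b. a \<in> A \<Longrightarrow> b \<in> B \<Longrightarrow> e \<le> dst a b"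
  shows "hausdorff_outer_measure dst X s A + hausdorff_outer_measure dst X s B
    \<le> hausdorff_outer_measure dst X s (A \<union> B)"
proof -
  let ?P = "hausdorff_premeasure dst X s" and ?H = "hausdorff_outer_measure dst X s"
  let ?w = "\<lambda>V. ennreal (unit_ball_vol (real s) / 2 ^ s) * diam_wrt dst V ^ s"
  have split: "?P \<delta> A + ?P \<delta> B \<le> ?P \<delta> (A \<union> B)" if "0 < \<delta>" "\<delta> < e" for \<delta>
    unfolding hausdorff_premeasure_def[of _ _ _ _ "A \<union> B"]
  proof (rule INF_greatest, clarify)
    fix U :: "nat \<Rightarrow> 'a set"
    assume U: "\<forall>i. U i \<subseteq> X \<and> diam_wrt dst (U i) \<le> ennreal \<delta>" and cov: "A \<union> B \<subseteq> (\<Union>i. U i)"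
    define V where "V C i = (if U i \<inter> C = {} then {} else U i)" for C i
    have P: "?P \<delta> C \<le> (\<Sum>i. ?w (V C i))" if C: "C \<subseteq> A \<union> B" for C
    proof (rule hausdorff_premeasure_le)
      show "C \<subseteq> (\<Union>i. V C i)"
      proof
        fix x assume "x \<in> C"
        then obtain i where "x \<in> U i" using cov C by blast
        with \<open>x \<in> C\<close> show "x \<in> (\<Union>i. V C i)" unfolding V_def by (intro UN_I[of i]) auto
      qed
    qed (use U in \<open>auto simp: V_def\<close>)
    have "U i \<inter> A = {} \<or> U i \<inter> B = {}" for i
    proof (rule ccontr)
      assume "\<not> ?thesis"
      then obtain a b where ab: "a \<in> A" "b \<in> B" "a \<in> U i" "b \<in> U i" by blast
      have "ennreal e \<le> ennreal (dst a b)" using sep ab by (intro ennreal_leI) auto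
      also have "\<dots> \<le> ennreal \<delta>" using le_diam_wrt[of a "U i" b dst] ab U order_trans by blast
      finally show False using that by simp
    qed
    then have le: "?w (V A i) + ?w (V B i) \<le> ?w (U i)" for i
      using s by (auto simp: V_def zero_power)
    have "?P \<delta> A + ?P \<delta> B \<le> (\<Sum>i. ?w (V A i)) + (\<Sum>i. ?w (V B i))"
      by (intro add_mono P) auto
    also have "\<dots> = (\<Sum>i. ?w (V A i) + ?w (V B i))" by (intro suminf_add) auto
    also have "\<dots> \<le> (\<Sum>i. ?w (U i))" using le by (intro suminf_le) auto
    finally show "?P \<delta> A + ?P \<delta> B \<le> (\<Sum>i. ?w (U i))" .
  qed
  have both: "?P \<delta> A + ?P \<delta>' B \<le> ?H (A \<union> B)" if "0 < \<delta>" "0 < \<delta>'" for \<delta> \<delta>'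
  proof -
    define \<eta> where "\<eta> = min (min \<delta> \<delta>') (e / 2)"
    have \<eta>: "0 < \<eta>" "\<eta> < e" "\<eta> \<le> \<delta>" "\<eta> \<le> \<delta>'" using that e by (auto simp: \<eta>_def)
    have "?P \<delta> A + ?P \<delta>' B \<le> ?P \<eta> A + ?P \<eta> B"
      using \<eta> by (intro add_mono hausdorff_premeasure_antimono)
    also have "\<dots> \<le> ?P \<eta> (A \<union> B)" using split \<eta> by blast
    also have "\<dots> \<le> ?H (A \<union> B)" using \<eta> by (intro hausdorff_premeasure_le_outer_measure)
    finally show ?thesis .
  qed
  have "?P \<delta> A + ?H B \<le> ?H (A \<union> B)" if "0 < \<delta>" for \<delta>
    unfolding hausdorff_outer_measure_def[of _ _ _ B]
    using that both by (subst ennreal_SUP_add_right) (auto intro!: SUP_least)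
  then show ?thesis
    unfolding hausdorff_outer_measure_def[of _ _ _ A]
    by (subst ennreal_SUP_add_left[symmetric]) (auto intro!: SUP_least)
qed

section \<open>Metric outer measures\<close>

lemma suminf_ennreal_tail_le:
  fixes f :: "nat \<Rightarrow> ennreal"
  assumes "(\<Sum>k. f k) < top" "0 < e"
  shows "\<exists>n. (\<Sum>k. f (k + n)) \<le> ennreal e"
proof -
  have "\<exists>n. (\<Sum>k. f k) \<le> (\<Sum>k<n. f k) + ennreal e"
  proof (rule ccontr)
    assume "\<not> ?thesis"
    then have "(\<Sum>k<n. f k) + ennreal e \<le> (\<Sum>k. f k)" for n by (meson linear)
    then have "(SUP n. (\<Sum>k<n. f k) + ennreal e) \<le> (\<Sum>k. f k)" by (rule SUP_least)
    then have "(\<Sum>k. f k) + ennreal e \<le> (\<Sum>k. f k)"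
      by (simp add: ennreal_SUP_add_left suminf_eq_SUP)
    then show False using assms by (simp add: less_top not_le[symmetric])
  qed
  then obtain n where n: "(\<Sum>k. f k) \<le> (\<Sum>k<n. f k) + ennreal e" ..
  have "(\<Sum>k. f k) = (\<Sum>k<n. f k) + (\<Sum>k. f (k + n))"
    using suminf_offset[of f n] by (simp add: add.commute)
  then have "(\<Sum>k<n. f k) + (\<Sum>k. f (k + n)) \<le> (\<Sum>k<n. f k) + ennreal e" using n by simp
  moreover have "(\<Sum>k<n. f k) < top"
    using le_less_trans[OF sum_le_suminf[of f "{..<n}"] assms(1)] by simp
  ultimately have "(\<Sum>k. f (k + n)) \<le> ennreal e"
    by (metis ennreal_add_left_cancel_le infinity_ennreal_def less_irrefl)
  then show ?thesis ..
qed

text \<open>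
  Caratheodory's criterion.  With \<open>g = infdist _ F\<close>, the part \<open>N n\<close> of \<open>A\<close> where \<open>g \<ge> 1/(n+1)\<close> is
  separated from \<open>A \<inter> F\<close>, so additivity holds for these two sets.  What is missing from \<open>A - F\<close> is
  contained in the shells \<open>R k\<close> with \<open>k \<ge> n\<close>.  Shells whose indices have the same parity are
  separated from each other, so the sum of \<open>f (R k)\<close> is at most \<open>2 * f A\<close>; its tails therefore
  vanish, and the missing part does not count in the limit.
\<close>

lemma metric_outer_measure_closed_measurable:
  fixes f :: "'a::metric_space set \<Rightarrow> ennreal"
  assumes oms: "outer_measure_space (Pow X) f"
    and sep: "\<And>A B e. A \<subseteq> X \<Longrightarrow> B \<subseteq> X \<Longrightarrow> 0 < e \<Longrightarrow> (\<And>a b. a \<in> A \<Longrightarrow> b \<in> B \<Longrightarrow> e \<le> dist a b)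
      \<Longrightarrow> f A + f B \<le> f (A \<union> B)"
    and F: "closed F"
  shows "X \<inter> F \<in> lambda_system X (Pow X) f"
proof -
  have pos: "f {} = 0" and inc: "\<And>A B. A \<subseteq> B \<Longrightarrow> B \<subseteq> X \<Longrightarrow> f A \<le> f B"
    and cs: "countably_subadditive (Pow X) f"
    using oms by (auto simp: outer_measure_space_def positive_def increasing_def)
  have sub: "f (A \<union> B) \<le> f A + f B" if "A \<subseteq> X" "B \<subseteq> X" "A \<inter> B = {}" for A B
  proof -
    interpret algebra X "Pow X" by (rule algebra_Pow)
    have "subadditive (Pow X) f"
      using countably_subadditive_subadditive[OF _ cs] oms by (simp add: outer_measure_space_def)
    then show ?thesis using that by (simp add: subadditive_def)
  qed
  have main: "f (A \<inter> F) + f (A - F) \<le> f A" if A: "A \<subseteq> X" for A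
  proof (cases "F = {} \<or> f A = top")
    case True then show ?thesis using pos by auto
  next
    case False
    then have Fne: "F \<noteq> {}" and fin: "f A < top" by (auto simp: less_top)
    define g where "g x = infdist x F" for x
    have g_dist: "g x \<le> g y + dist x y" for x y unfolding g_def by (rule infdist_triangle)
    define N where "N n = {x \<in> A. 1 / real (n + 1) \<le> g x}" for n
    define R where "R k = {x \<in> A. 1 / real (k + 2) \<le> g x \<and> g x < 1 / real (k + 1)}" for k
    have R_sub: "R k \<subseteq> A" for k by (auto simp: R_def)
    have half: "(\<Sum>k<m. f (R (2 * k + c))) \<le> f (\<Union>k<m. R (2 * k + c))" for m c
    proof (induction m)
      case 0 then show ?case by simp
    next
      case (Suc m)
      \<comment> \<open>For \<open>m = 0\<close> the union is empty and any positive separation will do; the formula in the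
        other branch could be negative there, as \<open>1 / 0 = 0\<close>.\<close>
      define e where "e = (if m = 0 then 1 else 1 / real (2 * m + c) - 1 / real (2 * m + c + 1))"
      have "0 < e" by (auto simp: e_def intro!: divide_strict_left_mono mult_pos_pos)
      have "(\<Sum>k<Suc m. f (R (2 * k + c))) \<le> f (\<Union>k<m. R (2 * k + c)) + f (R (2 * m + c))"
        using Suc by (simp add: add_right_mono)
      also have "\<dots> \<le> f ((\<Union>k<m. R (2 * k + c)) \<union> R (2 * m + c))"
      proof (rule sep[OF _ _ \<open>0 < e\<close>])
        fix a b assume "a \<in> (\<Union>k<m. R (2 * k + c))" and b: "b \<in> R (2 * m + c)"
        then obtain k where k: "k < m" "a \<in> R (2 * k + c)" by blast
        have "1 / real (2 * m + c) \<le> 1 / real (2 * k + c + 2)"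
          using k(1) by (intro divide_left_mono) auto
        also have "\<dots> \<le> g a" using k(2) by (simp add: R_def)
        finally have "1 / real (2 * m + c) \<le> g a" .
        moreover have "g b < 1 / real (2 * m + c + 1)" using b by (simp add: R_def)
        ultimately show "e \<le> dist a b" using g_dist[of a b] k(1) by (simp add: e_def)
      qed (use R_sub A in blast)+
      also have "(\<Union>k<m. R (2 * k + c)) \<union> R (2 * m + c) = (\<Union>k<Suc m. R (2 * k + c))"
        by (auto simp: lessThan_Suc)
      finally show ?case .
    qed
    have half': "(\<Sum>k<m. f (R (2 * k + c))) \<le> f A" for m c
      using half[of c m] by (rule order_trans) (use R_sub A in \<open>intro inc, auto\<close>)
    have "(\<Sum>k<n. f (R k)) \<le> f A + f A" for n
    proof -
      have "(\<Sum>k<n. f (R k)) \<le> (\<Sum>k<2 * n. f (R k))" by (intro sum_mono2) auto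
      also have "\<dots> = (\<Sum>k<n. f (R (2 * k + 0))) + (\<Sum>k<n. f (R (2 * k + 1)))"
        by (induction n) (simp_all add: add_ac)
      also have "\<dots> \<le> f A + f A" by (intro add_mono half')
      finally show ?thesis .
    qed
    then have "(\<Sum>k. f (R k)) \<le> f A + f A" by (intro suminf_le_const summableI)
    also have "\<dots> < top" using fin by simp
    finally have Rfin: "(\<Sum>k. f (R k)) < top" .
    have bound: "f (A \<inter> F) + f (A - F) \<le> f A + (\<Sum>k. f (R (k + n)))" for n
    proof -
      have cover: "A - F \<subseteq> N n \<union> (\<Union>k. R (k + n))"
      proof
        fix x assume x: "x \<in> A - F"
        then have "0 < g x"
          using F Fne in_closed_iff_infdist_zero[of F x] infdist_nonneg[of x F] by (auto simp: g_def less_le)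
        then obtain m0 where "1 / real (m0 + 1) < g x" using nat_approx_posE[of "g x"] by auto
        then have ex: "\<exists>m. 1 / real (m + 1) \<le> g x" by (auto intro: less_imp_le)
        define m where "m = (LEAST m. 1 / real (m + 1) \<le> g x)"
        have m: "1 / real (m + 1) \<le> g x" using LeastI_ex[OF ex] by (simp add: m_def)
        show "x \<in> N n \<union> (\<Union>k. R (k + n))"
        proof (cases "m \<le> n")
          case True
          then have "1 / real (n + 1) \<le> 1 / real (m + 1)" by (intro divide_left_mono) auto
          then show ?thesis using m x by (auto simp: N_def)
        next
          case False
          then obtain k where k: "m = k + n + 1" by (metis add.commute less_imp_Suc_add not_le Suc_eq_plus1 add_Suc_right)
          have "\<not> 1 / real (k + n + 1) \<le> g x"
            using not_less_Least[of "k + n" "\<lambda>m. 1 / real (m + 1) \<le> g x"] k m_def by auto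
          then have "x \<in> R (k + n)" using m x k by (auto simp: R_def add_ac)
          then show ?thesis by blast
        qed
      qed
      define S where "S = (\<Union>k. R (k + n))"
      have disj: "disjoint_family (\<lambda>k. R (k + n))"
      proof -
        have "R i \<inter> R j = {}" if "i < j" for i j
        proof -
          have "1 / real (j + 1) \<le> 1 / real (i + 2)" using that by (intro divide_left_mono) auto
          then show ?thesis by (auto simp: R_def)
        qed
        then show ?thesis
          unfolding disjoint_family_on_def by (metis Int_commute add_right_cancel nat_neq_iff)
      qed
      have "f (A - F) \<le> f (N n \<union> (S - N n))"
        using cover A by (intro inc) (auto simp: S_def N_def R_def)
      also have "\<dots> \<le> f (N n) + f (S - N n)"
        using A by (intro sub) (auto simp: S_def N_def R_def)
      also have "\<dots> \<le> f (N n) + f S"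
        using A by (intro add_left_mono inc) (auto simp: S_def R_def)
      also have "f S \<le> (\<Sum>k. f (R (k + n)))"
        unfolding S_def
        using cs[unfolded countably_subadditive_def, rule_format, of "\<lambda>k. R (k + n)"] disj
          order_trans[OF R_sub A] by (simp add: image_subset_iff UN_subset_iff)
      finally have 1: "f (A - F) \<le> f (N n) + (\<Sum>k. f (R (k + n)))" by (simp add: add_left_mono)
      have "f (A \<inter> F) + f (N n) \<le> f ((A \<inter> F) \<union> N n)"
      proof (rule sep[of _ _ "1 / real (n + 1)"])
        fix a b assume "a \<in> A \<inter> F" "b \<in> N n"
        then have "1 / real (n + 1) \<le> infdist b F" "infdist b F \<le> dist b a"
          by (auto simp: N_def g_def intro: infdist_le)
        then show "1 / real (n + 1) \<le> dist a b" by (simp add: dist_commute)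
      qed (use A in \<open>auto simp: N_def\<close>)
      also have "\<dots> \<le> f A" using A by (intro inc) (auto simp: N_def)
      finally have 2: "f (A \<inter> F) + f (N n) \<le> f A" .
      have "f (A \<inter> F) + f (A - F) \<le> (f (A \<inter> F) + f (N n)) + (\<Sum>k. f (R (k + n)))"
        using 1 by (simp add: add.assoc add_left_mono)
      also have "\<dots> \<le> f A + (\<Sum>k. f (R (k + n)))" using 2 by (rule add_right_mono)
      finally show ?thesis .
    qed
    show ?thesis
    proof (rule ennreal_le_epsilon)
      fix e :: real assume "0 < e"
      then obtain n where "(\<Sum>k. f (R (k + n))) \<le> ennreal e"
        using suminf_ennreal_tail_le[OF Rfin] by blast
      then show "f (A \<inter> F) + f (A - F) \<le> f A + ennreal e"
        using bound[of n] by (meson add_left_mono order_trans)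
    qed
  qed
  have "f (A \<inter> (X \<inter> F)) + f (A - X \<inter> F) = f A" if "A \<subseteq> X" for A
  proof -
    have eqs: "A \<inter> (X \<inter> F) = A \<inter> F" "A - X \<inter> F = A - F" using that by auto
    have "f A \<le> f (A \<inter> F) + f (A - F)"
      using sub[of "A \<inter> F" "A - F"] that by (auto simp: Int_Diff_Un)
    then show ?thesis using main[OF that] by (simp add: eqs)
  qed
  then show ?thesis
    by (simp add: algebra.lambda_system_eq[OF algebra_Pow])
qed

lemma measure_space_metric_outer_measure:
  fixes f :: "'a::metric_space set \<Rightarrow> ennreal"
  assumes oms: "outer_measure_space (Pow X) f"
    and sep: "\<And>A B e. A \<subseteq> X \<Longrightarrow> B \<subseteq> X \<Longrightarrow> 0 < e \<Longrightarrow> (\<And>a b. a \<in> A \<Longrightarrow> b \<in> B \<Longrightarrow> e \<le> dist a b)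
      \<Longrightarrow> f A + f B \<le> f (A \<union> B)"
  shows "measure_space X (sets (restrict_space borel X)) f"
proof -
  let ?L = "lambda_system X (Pow X) f"
  interpret P: sigma_algebra X "Pow X" by (rule sigma_algebra_Pow)
  have L: "measure_space X ?L f" using P.caratheodory_lemma[OF oms] .
  then interpret L: sigma_algebra X ?L by (simp add: measure_space_def)
  have "X \<inter> B \<in> ?L" if "B \<in> sets borel" for B
  proof -
    have "B \<in> sigma_sets UNIV (Collect closed)" using that by (simp add: borel_eq_closed)
    then show ?thesis
    proof induction
      case (Basic F)
      then show ?case by (intro metric_outer_measure_closed_measurable[OF oms] sep) auto
    next
      case (Compl B)
      have "X \<inter> (UNIV - B) = X - X \<inter> B" by blast
      then show ?case using Compl by (metis L.compl_sets)
    next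
      case (Union B)
      have "X \<inter> (\<Union>i. B i) = (\<Union>i. X \<inter> B i)" by blast
      moreover have "(\<Union>i. X \<inter> B i) \<in> ?L" using Union by (intro L.countable_UN) auto
      ultimately show ?case by simp
    qed auto
  qed
  then have sub: "sets (restrict_space borel X) \<subseteq> ?L" by (auto simp: sets_restrict_space)
  have "sigma_algebra X (sets (restrict_space borel X))"
    using sets.sigma_algebra_axioms[of "restrict_space borel X"] by (simp add: space_restrict_space)
  moreover have "positive (sets (restrict_space borel X)) f"
    using L by (simp add: measure_space_def positive_def)
  moreover have "countably_additive (sets (restrict_space borel X)) f"
    using L sub unfolding measure_space_def countably_additive_def by blast
  ultimately show ?thesis by (simp add: measure_space_def)
qed

section \<open>Geodesic and Euclidean distance on the sphere\<close>

lemma unit_inner_bounds: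
  fixes x y :: "'a::real_inner"
  assumes "norm x = 1" "norm y = 1"
  shows "- 1 \<le> x \<bullet> y" "x \<bullet> y \<le> 1"
  using Cauchy_Schwarz_ineq2[of x y] assms by auto

text \<open>
  The length of a chord in terms of its angle.  The two comparisons below, which follow from it, let
  Euclidean estimates replace geodesic ones in all that follows.
\<close>

lemma dist_eq_sin_geodesic_dist:
  fixes x y :: "real^'d"
  assumes "norm x = 1" "norm y = 1"
  shows "dist x y = 2 * sin (geodesic_dist x y / 2)"
proof -
  define t where "t = geodesic_dist x y"
  have t: "0 \<le> t" "t \<le> pi" "cos t = x \<bullet> y"
    using arccos[of "x \<bullet> y"] unit_inner_bounds[OF assms] by (auto simp: t_def geodesic_dist_def)
  have "(dist x y)\<^sup>2 = 2 - 2 * (x \<bullet> y)"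
    using assms by (simp add: dist_norm power2_norm_eq_inner inner_diff inner_commute norm_eq_1)
  also have "\<dots> = (2 * sin (t / 2))\<^sup>2"
    using cos_double_sin[of "t / 2"] t(3) by (simp add: power_mult_distrib)
  finally show ?thesis
    using t sin_ge_zero[of "t / 2"] unfolding t_def[symmetric]
    by (subst (asm) power2_eq_iff_nonneg) auto
qed

lemma dist_le_geodesic_dist:
  fixes x y :: "real^'d"
  assumes "norm x = 1" "norm y = 1"
  shows "dist x y \<le> geodesic_dist x y"
  using dist_eq_sin_geodesic_dist[OF assms] sin_x_le_x[of "geodesic_dist x y / 2"]
    arccos[of "x \<bullet> y"] unit_inner_bounds[OF assms] by (auto simp: geodesic_dist_def)

text \<open>
  With \<open>t\<close> a quarter of the angle, the claim reads \<open>t \<le> sin (2 * t) = 2 * sin t * cos t\<close>.  As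
  \<open>t \<le> pi / 4\<close>, both \<open>cos t\<close> and, by the mean value theorem, \<open>sin t / t\<close> are at least
  \<open>sqrt 2 / 2\<close>.
\<close>

lemma geodesic_dist_le_dist:
  fixes x y :: "real^'d"
  assumes "norm x = 1" "norm y = 1"
  shows "geodesic_dist x y \<le> 2 * dist x y"
proof -
  define t where "t = geodesic_dist x y / 4"
  have t: "0 \<le> t" "t \<le> pi / 4"
    using arccos[of "x \<bullet> y"] unit_inner_bounds[OF assms] by (auto simp: t_def geodesic_dist_def)
  have cos_ge: "sqrt 2 / 2 \<le> cos u" if "0 \<le> u" "u \<le> t" for u
    using cos_monotone_0_pi_le[of u "pi / 4"] that t by (simp add: cos_45)
  have "t * (sqrt 2 / 2) \<le> sin t"
  proof (cases "t = 0")
    case False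
    then obtain u where "0 < u" "u < t" "sin t - sin 0 = (t - 0) * cos u"
      using MVT2[of 0 t sin cos] t by auto
    then show ?thesis using cos_ge[of u] t by (simp add: mult_left_mono)
  qed simp
  then have "(t * (sqrt 2 / 2)) * (sqrt 2 / 2) \<le> sin t * cos t"
    using cos_ge[of t] t sin_ge_zero[of t] by (intro mult_mono) auto
  then have "t / 2 \<le> sin t * cos t" by (simp add: field_simps flip: power2_eq_square)
  then have "t \<le> sin (2 * t)" by (simp add: sin_double)
  then show ?thesis using dist_eq_sin_geodesic_dist[OF assms] by (simp add: t_def)
qed

text \<open>
  Radial projection to the sphere does not increase distances by more than a factor \<open>2\<close> as long as
  one of the points lies outside the open unit ball.
\<close>

lemma dist_normalized_le:
  fixes x y :: "'a::real_normed_vector"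
  assumes "norm x = 1" "norm y = 1" "1 \<le> a" "0 \<le> b"
  shows "dist x y \<le> 2 * norm (a *\<^sub>R x - b *\<^sub>R y)"
proof -
  have "dist x y \<le> a * norm (x - y)"
    using mult_right_mono[OF assms(3), of "norm (x - y)"] by (simp add: dist_norm)
  also have "\<dots> = norm (a *\<^sub>R (x - y))" using assms by simp
  also have "a *\<^sub>R (x - y) = (a *\<^sub>R x - b *\<^sub>R y) - (a - b) *\<^sub>R y" by (simp add: algebra_simps)
  also have "norm \<dots> \<le> norm (a *\<^sub>R x - b *\<^sub>R y) + norm ((a - b) *\<^sub>R y)" by (rule norm_triangle_ineq4)
  also have "norm ((a - b) *\<^sub>R y) = \<bar>norm (a *\<^sub>R x) - norm (b *\<^sub>R y)\<bar>" using assms by simp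
  also have "\<dots> \<le> norm (a *\<^sub>R x - b *\<^sub>R y)" by (rule norm_triangle_ineq3)
  finally show ?thesis by simp
qed

section \<open>Finiteness of the measure of the sphere\<close>

lemma hausdorff_premeasure_finite_cover_le:
  assumes s: "0 < s" and T: "finite T" and V: "\<And>t. t \<in> T \<Longrightarrow> V t \<subseteq> X"
    "\<And>t. t \<in> T \<Longrightarrow> diam_wrt dst (V t) \<le> ennreal D" "A \<subseteq> (\<Union>t\<in>T. V t)"
    and D: "D \<le> \<delta>"
  shows "hausdorff_premeasure dst X s \<delta> A
    \<le> of_nat (card T) * (ennreal (unit_ball_vol (real s) / 2 ^ s) * ennreal D ^ s)"
proof -
  let ?w = "\<lambda>V. ennreal (unit_ball_vol (real s) / 2 ^ s) * diam_wrt dst V ^ s"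
  define U where "U i = (if i < card T then V (from_nat_into T i) else {})" for i
  have bij: "bij_betw (from_nat_into T) {..<card T} T" by (rule bij_betw_from_nat_into_finite[OF T])
  have in_T: "from_nat_into T i \<in> T" if "i < card T" for i using bij that by (auto simp: bij_betw_def)
  have "hausdorff_premeasure dst X s \<delta> A \<le> (\<Sum>i. ?w (U i))"
  proof (rule hausdorff_premeasure_le)
    show "U i \<subseteq> X" for i using V in_T by (auto simp: U_def)
    show "diam_wrt dst (U i) \<le> ennreal \<delta>" for i
      using V(2)[OF in_T] ennreal_leI[OF D] by (auto simp: U_def intro: order_trans)
    show "A \<subseteq> (\<Union>i. U i)"
    proof
      fix x assume "x \<in> A"
      then obtain t where "t \<in> T" "x \<in> V t" using V(3) by blast
      moreover obtain i where "i < card T" "t = from_nat_into T i"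
        using bij \<open>t \<in> T\<close> by (auto simp: bij_betw_def image_iff)
      ultimately show "x \<in> (\<Union>i. U i)" by (intro UN_I[of i]) (auto simp: U_def)
    qed
  qed
  also have "\<dots> = (\<Sum>i<card T. ?w (U i))"
    using s by (intro suminf_finite) (auto simp: U_def zero_power)
  also have "\<dots> \<le> (\<Sum>i<card T. ennreal (unit_ball_vol (real s) / 2 ^ s) * ennreal D ^ s)"
    using V(2)[OF in_T] by (intro sum_mono mult_left_mono power_mono) (auto simp: U_def)
  also have "\<dots> = of_nat (card T) * (ennreal (unit_ball_vol (real s) / 2 ^ s) * ennreal D ^ s)"
    by simp
  finally show ?thesis .
qed

text \<open>
  The grid of mesh \<open>1/n\<close> on the faces of the cube \<open>[-1,1]\<^sup>d\<close>, projected radially to the sphere.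
  A label in \<open>T\<close> consists of the coordinate \<open>k x\<close> of largest modulus and its sign, which name a face,
  and of the cell of that face containing the projection \<open>a x *\<^sub>R x\<close> of \<open>x\<close>.  A face has only
  \<open>d - 1\<close> free coordinates, whence the exponent.
\<close>

lemma sphere_grid_cover:
  fixes n :: nat
  assumes n: "1 \<le> n"
  shows "\<exists>(T :: ('d::finite \<times> bool \<times> ('d \<Rightarrow> int)) set) (V :: _ \<Rightarrow> (real^'d) set).
    finite T \<and> card T = CARD('d) * 2 * (2 * n + 1) ^ (CARD('d) - 1) \<and>
    (\<forall>t. V t \<subseteq> sphere 0 1) \<and> sphere 0 1 \<subseteq> (\<Union>t\<in>T. V t) \<and>
    (\<forall>t. \<forall>x\<in>V t. \<forall>y\<in>V t. geodesic_dist x y \<le> 4 * real CARD('d) / n)"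
proof -
  define k where "k x = (SOME k. \<forall>j. \<bar>x $ j\<bar> \<le> \<bar>x $ k\<bar>)" for x :: "real^'d"
  have k: "\<bar>x $ j\<bar> \<le> \<bar>x $ k x\<bar>" for x j
  proof -
    have "Max (range (\<lambda>j. \<bar>x $ j\<bar>)) \<in> range (\<lambda>j. \<bar>x $ j\<bar>)" by (intro Max_in) auto
    then obtain k0 where "Max (range (\<lambda>j. \<bar>x $ j\<bar>)) = \<bar>x $ k0\<bar>" by (rule imageE)
    then have "\<forall>j. \<bar>x $ j\<bar> \<le> \<bar>x $ k0\<bar>" by (metis Max_ge finite finite_imageI rangeI)
    then have "\<forall>j. \<bar>x $ j\<bar> \<le> \<bar>x $ k x\<bar>" unfolding k_def by (rule someI)
    then show ?thesis ..
  qed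
  define a where "a x = 1 / \<bar>x $ k x\<bar>" for x :: "real^'d"
  define L where "L x = (k x, 0 < x $ k x, \<lambda>j\<in>UNIV - {k x}. \<lfloor>n * (a x * x $ j)\<rfloor>)" for x
  define T where "T = (SIGMA i:UNIV :: 'd set. (UNIV :: bool set) \<times> (\<Pi>\<^sub>E j\<in>UNIV - {i}. {- int n..int n}))"
  define V where "V t = {x \<in> sphere 0 1. L x = t}" for t
  have kpos: "0 < \<bar>x $ k x\<bar>" if "norm x = 1" for x
  proof -
    have "x \<noteq> 0" using that by auto
    then obtain j where "x $ j \<noteq> 0" by (auto simp: vec_eq_iff)
    then show ?thesis using k[of x j] by auto
  qed
  have a: "1 \<le> a x" if "norm x = 1" for x
    using kpos[OF that] component_le_norm_cart[of x "k x"] that by (simp add: a_def)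
  have coord: "\<bar>a x * x $ j\<bar> \<le> 1" if "norm x = 1" for x j
    using kpos[OF that] k[of x j] by (simp add: a_def abs_mult divide_simps)
  have fin: "finite T" unfolding T_def by (intro finite_SigmaI finite_cartesian_product finite_PiE finite finite_atLeastAtMost_int)
  have card_T: "card T = CARD('d) * 2 * (2 * n + 1) ^ (CARD('d) - 1)"
  proof -
    have "card T = (\<Sum>i\<in>(UNIV :: 'd set). 2 * (2 * n + 1) ^ (CARD('d) - 1))"
      unfolding T_def
      by (subst card_SigmaI) (auto simp: card_cartesian_product card_PiE card_Diff_singleton nat_add_distrib nat_mult_distrib
         intro!: finite_cartesian_product finite_PiE)
    then show ?thesis by simp
  qed
  have cover: "sphere 0 1 \<subseteq> (\<Union>t\<in>T. V t)"
  proof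
    fix x :: "real^'d" assume x: "x \<in> sphere 0 1"
    have "\<lfloor>n * (a x * x $ j)\<rfloor> \<in> {- int n..int n}" for j
    proof -
      have "\<bar>n * (a x * x $ j)\<bar> \<le> n" using coord[of x j] x n
        by (simp add: abs_mult)
      then show ?thesis by (auto simp: le_floor_iff floor_le_iff)
    qed
    then have "L x \<in> T" by (auto simp: L_def T_def)
    then show "x \<in> (\<Union>t\<in>T. V t)" using x by (auto simp: V_def)
  qed
  have diam: "geodesic_dist x y \<le> 4 * real CARD('d) / n" if "x \<in> V t" "y \<in> V t" for x y t
  proof -
    have nx: "norm x = 1" and ny: "norm y = 1" and L: "L x = L y" using that by (auto simp: V_def)
    have kk: "k y = k x" using L by (simp add: L_def)
    have "\<bar>(a x *\<^sub>R x - a y *\<^sub>R y) $ j\<bar> \<le> 1 / n" for j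
    proof (cases "j = k x")
      case True
      have "a x * x $ k x = a y * y $ k x"
        using L kk kpos[OF nx] kpos[OF ny] by (auto simp: L_def a_def abs_if split: if_splits)
      then show ?thesis using True by simp
    next
      case False
      have "(\<lambda>j\<in>UNIV - {k x}. \<lfloor>n * (a x * x $ j)\<rfloor>) = (\<lambda>j\<in>UNIV - {k x}. \<lfloor>n * (a y * y $ j)\<rfloor>)"
        using L kk by (simp only: L_def prod.inject)
      from fun_cong[OF this, of j] False
      have "\<lfloor>n * (a x * x $ j)\<rfloor> = \<lfloor>n * (a y * y $ j)\<rfloor>" by (simp only: restrict_apply) simp
      then have "\<bar>n * (a x * x $ j) - n * (a y * y $ j)\<bar> < 1" by linarith
      then have "real n * \<bar>a x * x $ j - a y * y $ j\<bar> < 1"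
        by (metis abs_mult abs_of_nat right_diff_distrib)
      then have "\<bar>a x * x $ j - a y * y $ j\<bar> \<le> 1 / n"
        using n by (simp add: pos_le_divide_eq mult.commute)
      then show ?thesis by simp
    qed
    then have "(\<Sum>j\<in>UNIV. \<bar>(a x *\<^sub>R x - a y *\<^sub>R y) $ j\<bar>) \<le> (\<Sum>j\<in>(UNIV :: 'd set). 1 / n)"
      by (intro sum_mono)
    then have "norm (a x *\<^sub>R x - a y *\<^sub>R y) \<le> CARD('d) / n"
      using norm_le_l1_cart[of "a x *\<^sub>R x - a y *\<^sub>R y"] by simp
    then show ?thesis
      using dist_normalized_le[OF nx ny a[OF nx] , of "a y"] a[OF ny] geodesic_dist_le_dist[OF nx ny] by simp
  qed
  show ?thesis
    by (intro exI[of _ T] exI[of _ V] conjI fin card_T cover) (use diam in \<open>auto simp: V_def\<close>)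
qed

text \<open>
  The number of grid cells is of order \<open>n\<^sup>s\<close> and their diameters are of order \<open>1/n\<close>, so the sums of
  the \<open>s\<close>-th powers of the diameters stay bounded as the mesh tends to \<open>0\<close>.
\<close>

lemma hausdorff_outer_measure_sphere_finite:
  assumes d: "2 \<le> CARD('d::finite)"
  shows "hausdorff_outer_measure geodesic_dist (sphere 0 1 :: (real^'d) set) (CARD('d) - 1) (sphere 0 1) < top"
proof -
  define d s where "d = CARD('d)" and "s = CARD('d) - 1"
  define c where "c = unit_ball_vol (real s) / 2 ^ s"
  have c: "0 \<le> c" by (simp add: c_def)
  have s: "0 < s" using assms by (simp add: s_def)
  have "hausdorff_premeasure geodesic_dist (sphere 0 1 :: (real^'d) set) s \<delta> (sphere 0 1)
      \<le> ennreal (d * 2 * c * (12 * real d) ^ s)" if "0 < \<delta>" for \<delta>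
  proof -
    obtain n :: nat where n: "4 * real d / \<delta> < n" using reals_Archimedean2 by blast
    have "0 < 4 * real d / \<delta>" using that by (simp add: d_def)
    then have n1: "1 \<le> n" using n by linarith
    obtain T :: "('d \<times> bool \<times> ('d \<Rightarrow> int)) set" and V :: "_ \<Rightarrow> (real^'d) set"
      where T: "finite T" "card T = d * 2 * (2 * n + 1) ^ s"
      and V: "\<forall>t. V t \<subseteq> sphere 0 1" "sphere 0 1 \<subseteq> (\<Union>t\<in>T. V t)"
        "\<forall>t. \<forall>x\<in>V t. \<forall>y\<in>V t. geodesic_dist x y \<le> 4 * real d / n"
      using sphere_grid_cover[OF n1, where 'd='d, folded s_def, folded d_def]
      by blast
    have "hausdorff_premeasure geodesic_dist (sphere 0 1 :: (real^'d) set) s \<delta> (sphere 0 1)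
      \<le> of_nat (card T) * (ennreal c * ennreal (4 * real d / n) ^ s)"
      unfolding c_def
    proof (rule hausdorff_premeasure_finite_cover_le[OF s T(1) V(1)[rule_format] _ V(2)])
      show "diam_wrt geodesic_dist (V t) \<le> ennreal (4 * real d / n)" for t
        unfolding diam_wrt_def by (intro SUP_least ennreal_leI V(3)[rule_format])
      show "4 * real d / n \<le> \<delta>" using n n1 that by (simp add: field_simps)
    qed
    also have "\<dots> = ennreal (card T * (c * (4 * real d / n) ^ s))"
      using c by (simp add: ennreal_mult ennreal_power ennreal_of_nat_eq_real_of_nat)
    also have "card T * (c * (4 * real d / n) ^ s) = d * 2 * c * ((2 * n + 1) * (4 * real d / n)) ^ s"
      unfolding T(2) power_mult_distrib by simp
    also have "(2 * n + 1) * (4 * real d / n) \<le> 12 * real d"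
    proof -
      have "4 * real d \<le> 4 * real d * real n" using mult_left_mono[of 1 "real n" "4 * real d"] n1 by simp
      then show ?thesis using n1 by (simp add: field_simps)
    qed
    then have "ennreal (d * 2 * c * ((2 * n + 1) * (4 * real d / n)) ^ s) \<le> ennreal (d * 2 * c * (12 * real d) ^ s)"
      using c by (intro ennreal_leI mult_left_mono power_mono) auto
    finally show ?thesis .
  qed
  then have "hausdorff_outer_measure geodesic_dist (sphere 0 1 :: (real^'d) set) s (sphere 0 1)
      \<le> ennreal (d * 2 * c * (12 * real d) ^ s)"
    unfolding hausdorff_outer_measure_def by (intro SUP_least) auto
  then show ?thesis unfolding s_def using ennreal_less_top le_less_trans by blast
qed

section \<open>Positivity of the measure of neighbourhoods of axis vectors\<close>

text \<open>
  Comparison with Lebesgue measure in \<open>\<real>\<^sup>d\<close>.  Translating a set \<open>U\<close> of diameter \<open>D \<le> 1\<close> by the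
  vectors \<open>t *\<^sub>R e\<close>, \<open>t \<in> [0,1]\<close>, where \<open>e\<close> is the \<open>k\<close>-th unit vector, sweeps out a set that lies in
  a box of volume at most \<open>(2 * D) ^ (d - 1) * 3\<close>.  On the other hand, sweeping
  \<open>sphere 0 1 \<inter> O'\<close> in this way covers a nonempty open set \<open>T\<close>.  Hence the sums
  \<open>\<Sum>i. diam (U i) ^ (d - 1)\<close> over covers of \<open>sphere 0 1 \<inter> O'\<close> cannot be smaller than a positive
  multiple of the volume of \<open>T\<close>.
\<close>

lemma hausdorff_outer_measure_axis_neighbourhood_pos:
  fixes O' :: "(real^'d) set" and k :: 'd
  assumes d: "2 \<le> CARD('d)" and O': "open O'" "axis k 1 \<in> O'"
  shows "0 < hausdorff_outer_measure geodesic_dist (sphere 0 1) (CARD('d) - 1) (sphere 0 1 \<inter> O')"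
proof -
  define s where "s = CARD('d) - 1"
  have s: "0 < s" using d by (simp add: s_def)
  define c where "c = unit_ball_vol (real s) / 2 ^ s"
  have c: "0 < c" by (simp add: c_def)
  define e where "e = (axis k 1 :: real^'d)"
  have e: "norm e = 1" "e $ k = 1" "e \<bullet> e = 1" "\<And>j. j \<noteq> k \<Longrightarrow> e $ j = 0"
    by (simp_all add: e_def inner_axis) (simp add: axis_def)
  \<comment> \<open>\<open>v\<close> projects along \<open>e\<close> to the upper hemisphere; \<open>q\<close> projects to the hyperplane orthogonal to \<open>e\<close>.\<close>
  define q where "q y = y - (y $ k) *\<^sub>R e" for y :: "real^'d"
  define v where "v y = q y + sqrt (1 - (norm (q y))\<^sup>2) *\<^sub>R e" for y
  \<comment> \<open>The bound \<open>1 / 2\<close> keeps the height of \<open>v y\<close> above \<open>1 / 2\<close>, so that together with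
    \<open>1 < y $ k < 3 / 2\<close> the vertical displacement from \<open>v y\<close> to \<open>y\<close> lies in \<open>[0,1]\<close>.\<close>
  define T where "T = {y. norm (q y) < 1 / 2} \<inter> {y. 1 < y $ k} \<inter> {y. y $ k < 3 / 2} \<inter> v -` O'"
  have qk: "q y $ k = 0" "q y \<bullet> e = 0" for y
    by (simp_all add: q_def e inner_diff_left) (simp add: e_def inner_axis)
  have cont: "continuous_on UNIV q" "continuous_on UNIV v"
    unfolding v_def q_def by (intro continuous_intros)+
  have "open T"
    unfolding T_def using cont O'(1)
    by (intro open_Int open_Collect_less open_vimage continuous_intros) auto
  moreover have "(5 / 4) *\<^sub>R e \<in> T"
    using O'(2) e by (simp add: T_def v_def q_def e_def[symmetric])
  ultimately have "\<not> negligible T" by (intro open_not_negligible) auto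
  then have m: "0 < emeasure lborel T"
    using \<open>open T\<close> by (auto simp: negligible_iff_null_sets null_sets_def zero_less_iff_neq_zero)
  have v_sphere: "v y \<in> sphere 0 1 \<inter> O'" and v_k: "y = v y + (y $ k - v y $ k) *\<^sub>R e"
    and v_box: "y $ k - v y $ k \<in> {0..1}" if y: "y \<in> T" for y
  proof -
    have q: "norm (q y) < 1 / 2" using y by (simp add: T_def)
    then have q2: "(norm (q y))\<^sup>2 \<le> (1 / 2)\<^sup>2" by (intro power_mono) auto
    have "orthogonal (q y) (sqrt (1 - (norm (q y))\<^sup>2) *\<^sub>R e)"
      using qk[of y] by (simp add: orthogonal_def)
    then have "(norm (v y))\<^sup>2 = (norm (q y))\<^sup>2 + (sqrt (1 - (norm (q y))\<^sup>2))\<^sup>2"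
      unfolding v_def by (simp add: norm_add_Pythagorean e)
    also have "\<dots> = 1" using q2 by (simp add: power_divide)
    finally have "(norm (v y))\<^sup>2 = 1" .
    then have "norm (v y) = 1" by (simp add: power2_eq_1_iff) (smt (verit) norm_ge_zero)
    then show "v y \<in> sphere 0 1 \<inter> O'" using y by (simp add: T_def)
    have vk: "v y $ k = sqrt (1 - (norm (q y))\<^sup>2)" using qk e by (simp add: v_def)
    show "y = v y + (y $ k - v y $ k) *\<^sub>R e" unfolding vk by (simp add: v_def q_def algebra_simps)
    have "sqrt (1 - (norm (q y))\<^sup>2) \<le> 1" by simp
    moreover have "1 / 2 \<le> sqrt (1 - (norm (q y))\<^sup>2)"
      using q2 by (intro real_le_rsqrt) (simp add: power_divide)
    moreover have "1 < y $ k" "y $ k < 3 / 2" using y by (simp_all add: T_def)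
    ultimately show "y $ k - v y $ k \<in> {0..1}" unfolding vk atLeastAtMost_iff by linarith
  qed
  have "c * emeasure lborel T / ennreal (3 * 2 ^ s)
      \<le> hausdorff_premeasure geodesic_dist (sphere 0 1) s 1 (sphere 0 1 \<inter> O')"
    unfolding hausdorff_premeasure_def
  proof (rule INF_greatest, clarify)
    fix U :: "nat \<Rightarrow> (real^'d) set"
    assume U: "\<forall>i. U i \<subseteq> sphere 0 1 \<and> diam_wrt geodesic_dist (U i) \<le> ennreal 1"
      and cov: "sphere 0 1 \<inter> O' \<subseteq> (\<Union>i. U i)"
    define D where "D i = enn2real (diam_wrt geodesic_dist (U i))" for i
    have D: "ennreal (D i) = diam_wrt geodesic_dist (U i)" "0 \<le> D i" "D i \<le> 1" for i
    proof -
      have "diam_wrt geodesic_dist (U i) \<le> 1" using U by simp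
      moreover from this have "diam_wrt geodesic_dist (U i) < top" using le_less_trans by fastforce
      ultimately show "ennreal (D i) = diam_wrt geodesic_dist (U i)" "0 \<le> D i" "D i \<le> 1"
        unfolding D_def by (simp_all add: enn2real_leI)
    qed
    define p where "p i = (SOME x. x \<in> U i)" for i
    define B where "B i = (if U i = {} then {}
      else cbox (p i - (\<chi> j. D i)) (p i + (\<chi> j. D i) + e))" for i
    have B: "emeasure lborel (B i) \<le> ennreal (3 * 2 ^ s) * ennreal (D i) ^ s" for i
    proof (cases "U i = {}")
      case False
      have "emeasure lborel (B i) = ennreal (\<Prod>j\<in>UNIV. 2 * D i + e $ j)"
      proof -
        let ?l = "p i - (\<chi> j. D i)" and ?u = "p i + (\<chi> j. D i) + e"
        have "0 \<le> e $ j" for j using e by (cases "j = k") auto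
        then have "cbox ?l ?u \<noteq> {}"
          using D(2)[of i] by (auto simp: interval_ne_empty_cart add_nonneg_nonneg)
        then have "measure lborel (cbox ?l ?u) = (\<Prod>j\<in>UNIV. 2 * D i + e $ j)"
          by (simp add: content_cbox_cart algebra_simps)
        then show ?thesis
          using False emeasure_eq_ennreal_measure[of lborel "cbox ?l ?u"]
            emeasure_lborel_cbox_finite[of ?l ?u] by (simp add: B_def)
      qed
      also have "(\<Prod>j\<in>UNIV. 2 * D i + e $ j) = (2 * D i + 1) * (\<Prod>j\<in>UNIV - {k}. 2 * D i)"
        using e by (subst prod.remove[of _ k]) auto
      also have "\<dots> = (2 * D i + 1) * (2 * D i) ^ s" by (simp add: s_def card_Diff_singleton)
      also have "\<dots> \<le> 3 * (2 * D i) ^ s" using D(2,3)[of i] by (intro mult_right_mono) auto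
      finally show ?thesis
        using D(2) by (simp add: ennreal_mult ennreal_power power_mult_distrib ennreal_leI mult.assoc)
    qed (simp add: B_def)
    have "T \<subseteq> (\<Union>i. B i)"
    proof
      fix y assume y: "y \<in> T"
      then obtain i where i: "v y \<in> U i" using v_sphere cov by blast
      then have p: "p i \<in> U i" unfolding p_def by (rule someI)
      have "dist (v y) (p i) \<le> geodesic_dist (v y) (p i)"
        using i p U by (intro dist_le_geodesic_dist) (auto simp: subset_iff)
      also have "\<dots> \<le> D i"
        using le_diam_wrt[OF i p, of geodesic_dist] D(1,2)[of i] by (metis ennreal_le_iff)
      finally have dist: "dist (v y) (p i) \<le> D i" .
      have "p i $ j - D i \<le> y $ j \<and> y $ j \<le> p i $ j + D i + e $ j" for j
      proof -
        have "\<bar>v y $ j - p i $ j\<bar> \<le> D i"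
          using component_le_norm_cart[of "v y - p i" j] dist by (simp add: dist_norm)
        moreover have "y $ j = v y $ j + (y $ k - v y $ k) * e $ j"
          using arg_cong[OF v_k[OF y], of "\<lambda>z. z $ j"] by simp
        moreover have "0 \<le> (y $ k - v y $ k) * e $ j \<and> (y $ k - v y $ k) * e $ j \<le> e $ j"
        proof (cases "j = k")
          case True then show ?thesis using v_box[OF y] e(2) by simp
        next
          case False then show ?thesis using e(4) by simp
        qed
        ultimately show ?thesis by linarith
      qed
      then have "y \<in> cbox (p i - (\<chi> j. D i)) (p i + (\<chi> j. D i) + e)"
        by (simp add: mem_box_cart)
      then show "y \<in> (\<Union>i. B i)" using i by (auto simp: B_def)
    qed
    then have "emeasure lborel T \<le> emeasure lborel (\<Union>i. B i)"
      by (intro emeasure_mono) (auto simp: B_def)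
    also have "\<dots> \<le> (\<Sum>i. emeasure lborel (B i))"
      by (intro emeasure_subadditive_countably) (auto simp: B_def)
    also have "\<dots> \<le> (\<Sum>i. ennreal (3 * 2 ^ s) * ennreal (D i) ^ s)" using B by (intro suminf_le) auto
    also have "\<dots> = ennreal (3 * 2 ^ s) * (\<Sum>i. ennreal (D i) ^ s)" by simp
    finally have "emeasure lborel T / ennreal (3 * 2 ^ s) \<le> (\<Sum>i. ennreal (D i) ^ s)"
      by (intro divide_le_posI_ennreal) (auto simp: mult.commute)
    then have "c * (emeasure lborel T / ennreal (3 * 2 ^ s)) \<le> ennreal c * (\<Sum>i. ennreal (D i) ^ s)"
      by (rule mult_left_mono) auto
    then show "c * emeasure lborel T / ennreal (3 * 2 ^ s)
       \<le> (\<Sum>i. ennreal (unit_ball_vol (real s) / 2 ^ s) * diam_wrt geodesic_dist (U i) ^ s)"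
      by (simp add: c_def D(1) ennreal_times_divide)
  qed
  also have "\<dots> \<le> hausdorff_outer_measure geodesic_dist (sphere 0 1) s (sphere 0 1 \<inter> O')"
    by (intro hausdorff_premeasure_le_outer_measure) simp
  finally have "c * emeasure lborel T / ennreal (3 * 2 ^ s)
      \<le> hausdorff_outer_measure geodesic_dist (sphere 0 1) s (sphere 0 1 \<inter> O')" .
  moreover have "0 < c * emeasure lborel T / ennreal (3 * 2 ^ s)"
    using m c by (simp add: ennreal_zero_less_divide ennreal_zero_less_mult_iff)
  ultimately show ?thesis unfolding s_def by (rule less_le_trans[rotated])
qed

section \<open>The spherical measure\<close>

lemma space_sphere_measure: "space (sphere_measure :: (real^'d) measure) = sphere 0 1"
  and sets_sphere_measure:
    "sets (sphere_measure :: (real^'d) measure) = sets (restrict_space borel (sphere 0 1))"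
proof -
  have sub: "sets (restrict_space borel (sphere 0 1 :: (real^'d) set)) \<subseteq> Pow (sphere 0 1)"
    using sets.space_closed[of "restrict_space borel (sphere 0 1 :: (real^'d) set)"]
    by (simp add: space_restrict_space)
  show "space (sphere_measure :: (real^'d) measure) = sphere 0 1"
    unfolding sphere_measure_def by (rule space_measure_of[OF sub])
  show "sets (sphere_measure :: (real^'d) measure) = sets (restrict_space borel (sphere 0 1))"
    unfolding sphere_measure_def sets_measure_of[OF sub]
    using sets.sigma_sets_eq[of "restrict_space borel (sphere 0 1 :: (real^'d) set)"]
    by (simp add: space_restrict_space)
qed

text \<open>
  Since \<open>measure_of\<close> yields the zero measure when its argument is not countably additive, this needs
  Caratheodory's criterion; separation in the Euclidean distance implies geodesic separation.
\<close>

lemma emeasure_sphere_measure: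
  fixes A :: "(real^'d) set"
  assumes d: "2 \<le> CARD('d)" and A: "A \<in> sets sphere_measure"
  shows "emeasure sphere_measure A
    = hausdorff_outer_measure geodesic_dist (sphere 0 1) (CARD('d) - 1) A"
proof -
  let ?X = "sphere 0 1 :: (real^'d) set"
  let ?H = "hausdorff_outer_measure geodesic_dist ?X (CARD('d) - 1)"
  have s: "0 < CARD('d) - 1" using d by simp
  have "measure_space ?X (sets (restrict_space borel ?X)) ?H"
  proof (rule measure_space_metric_outer_measure[OF outer_measure_space_hausdorff[OF s]])
    fix A B :: "(real^'d) set" and e
    assume AB: "A \<subseteq> ?X" "B \<subseteq> ?X" and e: "0 < e"
      and sep: "\<And>a b. a \<in> A \<Longrightarrow> b \<in> B \<Longrightarrow> e \<le> dist a b"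
    show "?H A + ?H B \<le> ?H (A \<union> B)"
    proof (rule hausdorff_outer_measure_separated[OF s e])
      fix a b assume ab: "a \<in> A" "b \<in> B"
      then have "dist a b \<le> geodesic_dist a b"
        using AB by (intro dist_le_geodesic_dist) (auto simp: subset_iff)
      then show "e \<le> geodesic_dist a b" using sep[OF ab] by linarith
    qed
  qed
  then show ?thesis
    using A unfolding sets_sphere_measure unfolding sphere_measure_def
    by (intro emeasure_measure_of_sigma) (auto simp: measure_space_def)
qed

section \<open>Fractional division by an affine function\<close>

text \<open>
  The dividing function is \<open>f v = 1/r + w \<bullet> v\<close>.  As \<open>w \<bullet> (\<gamma>\<^sub>i\<^sup>-\<^sup>1 v) = (\<gamma>\<^sub>i w) \<bullet> v\<close>, its translates sum
  to \<open>1\<close> at every point.  It differs from \<open>1/r\<close> on a relatively open subset of the sphere that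
  contains the \<open>k\<close>-th unit vector whenever \<open>w $ k \<noteq> 0\<close>.
\<close>

lemma fractionally_divides_if_images_sum_zero:
  fixes \<gamma> :: "nat \<Rightarrow> real^'d^'d"
  assumes d: "2 \<le> CARD('d)" and r: "1 \<le> r" and \<gamma>: "\<And>i. i \<in> {1..r} \<Longrightarrow> \<gamma> i \<in> SO"
    and w: "w \<noteq> 0" and sum: "(\<Sum>i=1..r. \<gamma> i *v w) = 0"
  shows "fractionally_divides r \<gamma>"
proof -
  let ?M = "sphere_measure :: (real^'d) measure"
  define f where "f v = 1 / real r + w \<bullet> v" for v
  have "continuous_on UNIV f" unfolding f_def by (intro continuous_intros)
  then have "f \<in> borel_measurable (restrict_space borel (sphere 0 1))"
    by (intro measurable_restrict_space1 borel_measurable_continuous_onI)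
  then have meas: "f \<in> borel_measurable ?M"
    using measurable_cong_sets[OF sets_sphere_measure refl] by blast
  have whole: "sphere 0 1 \<in> sets ?M" by (metis sets.top space_sphere_measure)
  interpret finite_measure ?M
    using emeasure_sphere_measure[OF d whole] hausdorff_outer_measure_sphere_finite[OF d]
    by (intro finite_measureI) (simp add: space_sphere_measure)
  have "integrable ?M (\<lambda>v. (f v)\<^sup>2)"
  proof (rule integrable_const_bound)
    show "AE v in ?M. norm ((f v)\<^sup>2) \<le> (1 / real r + norm w)\<^sup>2"
    proof (rule AE_I2)
      fix v assume "v \<in> space ?M"
      then have "\<bar>w \<bullet> v\<bar> \<le> norm w" using Cauchy_Schwarz_ineq2[of w v] by (simp add: space_sphere_measure)
      moreover have "0 \<le> 1 / real r" by simp
      ultimately have "\<bar>f v\<bar> \<le> 1 / real r + norm w" unfolding f_def by linarith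
      then have "\<bar>f v\<bar>\<^sup>2 \<le> (1 / real r + norm w)\<^sup>2" by (rule power_mono) simp
      then show "norm ((f v)\<^sup>2) \<le> (1 / real r + norm w)\<^sup>2" by simp
    qed
    show "(\<lambda>v. (f v)\<^sup>2) \<in> borel_measurable ?M" using meas by measurable
  qed
  with meas have L2: "f \<in> real_L2 ?M" by (simp add: real_L2_def)
  have act: "act (\<gamma> i) f v = 1 / real r + (\<gamma> i *v w) \<bullet> v" if "i \<in> {1..r}" for i v
  proof -
    have orth: "\<gamma> i ** transpose (\<gamma> i) = mat 1" "transpose (\<gamma> i) ** \<gamma> i = mat 1"
      using \<gamma>[OF that] by (simp_all add: SO_def rotation_matrix_def orthogonal_matrix_def)
    have "\<gamma> i ** matrix_inv (\<gamma> i) = mat 1 \<and> matrix_inv (\<gamma> i) ** \<gamma> i = mat 1"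
      unfolding matrix_inv_def
      by (rule someI[where P = "\<lambda>B. \<gamma> i ** B = mat 1 \<and> B ** \<gamma> i = mat 1", OF conjI[OF orth]])
    then have "matrix_inv (\<gamma> i) = (transpose (\<gamma> i) ** \<gamma> i) ** matrix_inv (\<gamma> i)"
        and "transpose (\<gamma> i) = transpose (\<gamma> i) ** (\<gamma> i ** matrix_inv (\<gamma> i))"
      using orth by simp_all
    then have "matrix_inv (\<gamma> i) = transpose (\<gamma> i)" by (simp only: matrix_mul_assoc)
    moreover have "w \<bullet> (transpose (\<gamma> i) *v v) = (\<gamma> i *v w) \<bullet> v"
      using dot_lmul_matrix[of w "transpose (\<gamma> i)" v] by simp
    ultimately show ?thesis by (simp add: act_def f_def)
  qed
  have sum_one: "(\<Sum>i=1..r. act (\<gamma> i) f v) = 1" for v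
  proof -
    have "(\<Sum>i=1..r. act (\<gamma> i) f v) = (\<Sum>i=1..r. 1 / real r) + (\<Sum>i=1..r. \<gamma> i *v w) \<bullet> v"
      by (simp add: act sum.distrib inner_sum_left)
    then show ?thesis using r sum by simp
  qed
  have nonconst: "0 < emeasure ?M {v \<in> space ?M. f v \<noteq> 1 / real r}"
  proof -
    obtain k where k: "w $ k \<noteq> 0" using w by (auto simp: vec_eq_iff)
    let ?O = "{v. w \<bullet> v \<noteq> 0}"
    have "open ?O" by (intro open_Collect_neq continuous_intros)
    have eq: "{v \<in> space ?M. f v \<noteq> 1 / real r} = sphere 0 1 \<inter> ?O"
      by (auto simp: f_def space_sphere_measure)
    have "sphere 0 1 \<inter> ?O \<in> sets ?M"
      unfolding sets_sphere_measure sets_restrict_space by (intro imageI borel_open \<open>open ?O\<close>)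
    moreover have "axis k 1 \<in> ?O" using k by (simp add: inner_axis)
    ultimately show ?thesis
      unfolding eq using hausdorff_outer_measure_axis_neighbourhood_pos[OF d \<open>open ?O\<close>]
      by (simp only: emeasure_sphere_measure[OF d])
  qed
  show ?thesis
    unfolding fractionally_divides_def
    by (rule bexI[OF _ L2], rule conjI, rule AE_I2, rule sum_one, rule nonconst)
qed

section \<open>The whole group is neither meager nor Haar-null\<close>

lemma closed_SO: "closed (SO :: (real^'d^'d) set)"
proof -
  have eq: "SO = {A :: real^'d^'d. transpose A ** A = mat 1} \<inter> {A. det A = 1}"
    by (auto simp: SO_def rotation_matrix_def orthogonal_matrix)
  have "closed {A :: real^'d^'d. transpose A ** A = mat 1}"
    unfolding matrix_matrix_mult_def transpose_def
    by (intro closed_Collect_eq continuous_intros)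
  moreover have "closed {A :: real^'d^'d. det A = 1}"
    unfolding det_def by (intro closed_Collect_eq continuous_intros)
  ultimately show ?thesis unfolding eq by (rule closed_Int)
qed

lemma mat_1_in_SO: "mat 1 \<in> SO"
  by (simp add: SO_def rotation_matrix_def orthogonal_matrix_id)

lemma topspace_SO_power: "topspace (SO_power_topology l) = (SO_tuples {1..l} :: (nat \<Rightarrow> real^'d^'d) set)"
  by (simp add: SO_power_topology_def SO_tuples_def)

lemma SO_tuples_nonempty: "(SO_tuples I :: (nat \<Rightarrow> real^'d^'d) set) \<noteq> {}"
  using mat_1_in_SO unfolding SO_tuples_def PiE_eq_empty_iff by blast

text \<open>
  The group is closed in a Euclidean space, so its finite powers are completely metrizable and
  Baire's category theorem applies.
\<close>

lemma SO_tuples_not_meager: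
  "\<not> meager_in (SO_power_topology l) (SO_tuples {1..l} :: (nat \<Rightarrow> real^'d^'d) set)"
proof
  let ?X = "SO_power_topology l :: (nat \<Rightarrow> real^'d^'d) topology"
  assume "meager_in ?X (SO_tuples {1..l})"
  then obtain N where N: "\<And>n::nat. nowhere_dense_in ?X (N n)" "topspace ?X = (\<Union>n. N n)"
    unfolding meager_in_def topspace_SO_power by auto
  have "completely_metrizable_space (top_of_set (SO :: (real^'d^'d) set))"
    using closed_SO by (intro completely_metrizable_space_closedin completely_metrizable_space_euclidean) simp
  then have "completely_metrizable_space ?X"
    unfolding SO_power_topology_def completely_metrizable_space_product_topology
    by (auto intro: countable_subset[of _ "{1..l}"])
  then have "?X interior_of (\<Union>(range (\<lambda>n. ?X closure_of N n))) = {}"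
    using N(1) by (intro Baire_category_alt) (auto simp: nowhere_dense_in_def)
  moreover have "topspace ?X \<subseteq> (\<Union>(range (\<lambda>n. ?X closure_of N n)))"
    unfolding N(2) using N(1) closure_of_subset[of "N _" ?X] by (fastforce simp: nowhere_dense_in_def)
  then have "?X interior_of topspace ?X \<subseteq> ?X interior_of (\<Union>(range (\<lambda>n. ?X closure_of N n)))"
    by (rule interior_of_mono)
  ultimately have "topspace ?X = {}" by simp
  then show False by (simp only: topspace_SO_power SO_tuples_nonempty)
qed

lemma SO_tuples_not_haar_null:
  "\<not> haar_null_in (SO_power_topology l) mlt (SO_tuples {1..l} :: (nat \<Rightarrow> real^'d^'d) set)"
proof
  assume "haar_null_in (SO_power_topology l) mlt (SO_tuples {1..l} :: (nat \<Rightarrow> real^'d^'d) set)"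
  then obtain M :: "(nat \<Rightarrow> real^'d^'d) measure" and N where M: "prob_space M"
    and N: "N \<in> null_sets M" "space M \<subseteq> N"
    unfolding haar_null_in_def haar_prob_measure_def topspace_SO_power by auto
  interpret prob_space M by (rule M)
  have "emeasure M (space M) \<le> emeasure M N" using N by (intro emeasure_mono) auto
  then show False using N emeasure_space_1 by auto
qed

text \<open>
  The lower bounds below come from sections that are as large as possible.  For \<open>l = 0\<close> this is the
  only way for a section to be nonempty.
\<close>

lemma le_f_top_f_Haar:
  assumes "\<And>l. l < k \<Longrightarrow> \<exists>\<gamma>'\<in>SO_tuples {l+1..r}.
    dividing_section r l \<gamma>' = (SO_tuples {1..l} :: (nat \<Rightarrow> real^'d^'d) set)"
  shows "enat k \<le> f_top TYPE('d) r" "enat k \<le> f_Haar TYPE('d) r"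
  unfolding f_top_def f_Haar_def
  using assms SO_tuples_not_meager[where 'd='d] SO_tuples_not_haar_null[where 'd='d]
  by (intro INF_greatest; simp; metis not_le)+

section \<open>Tuples of rotations with singular sum\<close>

lemma ex_distinct_pair:
  assumes "2 \<le> CARD('a::finite)"
  shows "\<exists>a b :: 'a. a \<noteq> b"
proof -
  have "(UNIV :: 'a set) \<noteq> {a}" for a
  proof
    assume "(UNIV :: 'a set) = {a}"
    then have "CARD('a) = card {a}" by (rule arg_cong)
    then show False using assms by simp
  qed
  then show ?thesis by blast
qed

text \<open>
  The \<open>r\<close>-th roots of unity, drawn in a coordinate plane, are unit vectors with sum \<open>0\<close>, and every unit
  vector is the image of a given one under a rotation.
\<close>

lemma roots_of_unity_tuple:
  assumes d: "2 \<le> CARD('d)" and r: "2 \<le> r"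
  obtains \<gamma> :: "nat \<Rightarrow> real^'d^'d" and w where "\<And>i. \<gamma> i \<in> SO" "w \<noteq> 0" "(\<Sum>i=1..r. \<gamma> i *v w) = 0"
proof -
  obtain a b :: 'd where ab: "a \<noteq> b" using ex_distinct_pair[where 'a='d] d by fastforce
  \<comment> \<open>The shift \<open>i - 1\<close> makes \<open>i = 1, \<dots>, r\<close> run through the exponents \<open>0, \<dots>, r - 1\<close>.\<close>
  define u :: "nat \<Rightarrow> real^'d" where "u i = cos (2 * pi * real (i - 1) / real r) *\<^sub>R axis a 1
    + sin (2 * pi * real (i - 1) / real r) *\<^sub>R axis b 1" for i
  have norm_u: "norm (u i) = 1" for i
  proof -
    have "u i \<bullet> u i = 1"
      using ab by (simp add: u_def inner_add_left inner_add_right inner_axis_axis flip: power2_eq_square)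
    then show ?thesis by (simp add: norm_eq_1)
  qed
  have "\<exists>A \<in> SO. A *v axis a 1 = u i" for i
  proof -
    obtain f where f: "orthogonal_transformation f" "det (matrix f) = 1" "f (axis a 1) = u i"
      using rotation_exists_1[OF d, of "axis a 1" "u i"] norm_u by auto
    then have "matrix f \<in> SO" "matrix f *v axis a 1 = u i"
      by (auto simp: SO_def rotation_matrix_def orthogonal_transformation_matrix matrix_works)
    then show ?thesis by blast
  qed
  then obtain \<gamma> where \<gamma>: "\<And>i. \<gamma> i \<in> SO" "\<And>i. \<gamma> i *v axis a 1 = u i" by metis
  have "(\<Sum>k<r. cis (2 * pi * real k / real r)) = \<Sum>{z. z ^ r = 1}"
    using r Complex.bij_betw_roots_unity[of r] by (intro sum.reindex_bij_betw) simp
  then have "(\<Sum>k<r. cis (2 * pi * real k / real r)) = 0" using sum_roots_unity r by simp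
  then have "(\<Sum>k<r. cos (2 * pi * real k / real r)) = 0" "(\<Sum>k<r. sin (2 * pi * real k / real r)) = 0"
    by (simp_all add: complex_eq_iff)
  then have "(\<Sum>i=1..r. u i) = 0"
    by (simp add: u_def sum.distrib sum.atLeast1_atMost_eq flip: scaleR_sum_left)
  then show ?thesis using that[of \<gamma> "axis a 1"] \<gamma> by (simp add: axis_eq_0_iff)
qed

text \<open>
  Euler's argument: as \<open>A\<close> is orthogonal, \<open>A - 1 = A (1 - A)\<^sup>T\<close>, so that
  \<open>det (A - 1) = det (1 - A) = - det (A - 1)\<close> in odd dimension.
\<close>

lemma odd_rotation_fixed_vector:
  fixes A :: "real^'d^'d"
  assumes "odd CARD('d)" "A \<in> SO"
  obtains w where "w \<noteq> 0" "A *v w = w"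
proof -
  have A: "A ** transpose A = mat 1" "det A = 1"
    using assms(2) by (simp_all add: SO_def rotation_matrix_def orthogonal_matrix_def)
  have t: "transpose (mat 1 - A) = mat 1 - transpose A"
    by (simp add: transpose_def mat_def vec_eq_iff)
  have "A ** (mat 1 - transpose A) + A ** transpose A = A"
    by (simp flip: matrix_add_ldistrib)
  then have "A - mat 1 = A ** transpose (mat 1 - A)"
    unfolding t A(1) by (metis add_diff_cancel_right')
  then have "det (A - mat 1) = det (mat 1 - A)" by (metis A(2) det_mul det_transpose mult_1)
  also have "mat 1 - A = (\<chi> i. (- 1) *s ((A - mat 1) $ i))" by (simp add: vec_eq_iff)
  also have "det \<dots> = (- 1) ^ CARD('d) * det (A - mat 1)"
    by (subst det_rows_mul) simp
  finally have "det (A - mat 1) = 0" using assms(1) by simp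
  then have "\<not> (\<exists>B. B ** (A - mat 1) = mat 1)"
    using invertible_det_nz invertible_left_inverse by blast
  then obtain w where "w \<noteq> 0" "(A - mat 1) *v w = 0"
    unfolding matrix_left_invertible_ker by blast
  then show ?thesis using that by (simp add: matrix_vector_mult_diff_rdistrib)
qed

definition diag_matrix :: "('d \<Rightarrow> real) \<Rightarrow> real^'d^'d" where
  "diag_matrix c = (\<chi> i j. if i = j then c i else 0)"

lemma diag_matrix_mult_vec: "diag_matrix c *v x = (\<chi> i. c i * x $ i)"
  by (simp add: diag_matrix_def matrix_vector_mult_def vec_eq_iff if_distrib[of "\<lambda>t. t * _"] cong: if_cong)

lemma diag_matrix_sign_in_SO:
  assumes sign: "\<And>i. c i = 1 \<or> c i = - 1" and even: "even (card {i. c i = - 1})"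
  shows "diag_matrix c \<in> SO"
proof -
  have "c i * c i = 1" for i using sign[of i] by auto
  then have "transpose (diag_matrix c) ** diag_matrix c = mat 1"
    by (simp add: diag_matrix_def transpose_def matrix_matrix_mult_def mat_def vec_eq_iff
        if_distrib[of "\<lambda>t. t * _"] if_distrib[of "\<lambda>t. _ * t"] cong: if_cong)
  moreover have "det (diag_matrix c) = 1"
  proof -
    have "det (diag_matrix c) = (\<Prod>i\<in>UNIV. c i)" by (subst det_diagonal) (auto simp: diag_matrix_def)
    also have "\<dots> = (\<Prod>i\<in>UNIV. if c i = - 1 then - 1 else 1)"
      using sign by (intro prod.cong) auto
    also have "\<dots> = (- 1) ^ card {i. c i = - 1}" by (subst prod.If_cases) auto
    finally show ?thesis using even by simp
  qed
  ultimately show ?thesis by (simp add: SO_def rotation_matrix_def orthogonal_matrix)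
qed

text \<open>
  The columns of signs are \<open>(+,-,-)\<close>, \<open>(-,+,-)\<close> and, for all remaining indices, \<open>(-,-,+)\<close>: each sums
  to \<open>-1\<close>.  The matrices have \<open>d - 1\<close>, \<open>d - 1\<close> and \<open>2\<close> negative signs, all even since \<open>d\<close> is odd, so they
  are rotations.
\<close>

lemma three_sign_matrices:
  assumes d: "3 \<le> CARD('d)" "odd CARD('d)"
  obtains A B C :: "real^'d^'d" where "A \<in> SO" "B \<in> SO" "C \<in> SO" "\<And>x. A *v x + B *v x + C *v x = - x"
proof -
  obtain a b :: 'd where ab: "a \<noteq> b" using ex_distinct_pair[where 'a='d] d by fastforce
  define cA cB cC :: "'d \<Rightarrow> real" where "cA j = (if j = a then 1 else - 1)"
    and "cB j = (if j = b then 1 else - 1)" and "cC j = (if j = a \<or> j = b then - 1 else 1)" for j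
  have "{j. cA j = - 1} = UNIV - {a}" "{j. cB j = - 1} = UNIV - {b}" "{j. cC j = - 1} = {a, b}"
    by (auto simp: cA_def cB_def cC_def)
  then have "even (card {j. cA j = - 1})" "even (card {j. cB j = - 1})" "even (card {j. cC j = - 1})"
    using d ab by (simp_all add: card_Diff_singleton)
  then have "diag_matrix cA \<in> SO" "diag_matrix cB \<in> SO" "diag_matrix cC \<in> SO"
    by (intro diag_matrix_sign_in_SO; simp add: cA_def cB_def cC_def)+
  moreover have "diag_matrix cA *v x + diag_matrix cB *v x + diag_matrix cC *v x = - x" for x
    using ab by (auto simp: diag_matrix_mult_vec vec_eq_iff cA_def cB_def cC_def)
  ultimately show ?thesis by (rule that)
qed

section \<open>Sections that are the whole group\<close>

lemma roots_of_unity_section_full: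
  assumes d: "2 \<le> CARD('d)" and r: "2 \<le> r"
  shows "\<exists>\<gamma>'\<in>SO_tuples {0+1..r}. dividing_section r 0 \<gamma>' = (SO_tuples {1..0} :: (nat \<Rightarrow> real^'d^'d) set)"
proof -
  obtain \<gamma> :: "nat \<Rightarrow> real^'d^'d" and w
    where \<gamma>: "\<And>i. \<gamma> i \<in> SO" "w \<noteq> 0" "(\<Sum>i=1..r. \<gamma> i *v w) = 0"
    using roots_of_unity_tuple[OF d r] by blast
  define \<gamma>' where "\<gamma>' = restrict \<gamma> {1..r}"
  have "merge {1..0} {0+1..r} (g, \<gamma>') = \<gamma>'" for g
    by (auto simp: merge_def \<gamma>'_def fun_eq_iff)
  moreover have "\<gamma>' \<in> SO_tuples {1..r}" using \<gamma> by (auto simp: \<gamma>'_def SO_tuples_def)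
  moreover have "fractionally_divides r \<gamma>'"
    using \<gamma> r by (intro fractionally_divides_if_images_sum_zero[OF d, of _ _ w]) (auto simp: \<gamma>'_def)
  ultimately show ?thesis
    by (intro bexI[of _ \<gamma>']) (auto simp: dividing_section_def dividing_tuples_def)
qed

text \<open>
  With the three sign matrices fixed, the sum of the four rotations is \<open>\<gamma>\<^sub>1 - 1\<close>, which kills the
  fixed vectors of \<open>\<gamma>\<^sub>1\<close>.  So every choice of \<open>\<gamma>\<^sub>1\<close> divides.
\<close>

lemma sign_matrices_section_full:
  assumes d: "3 \<le> CARD('d)" "odd CARD('d)"
  shows "\<exists>\<gamma>'\<in>SO_tuples {1+1..4}. dividing_section 4 1 \<gamma>' = (SO_tuples {1..1} :: (nat \<Rightarrow> real^'d^'d) set)"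
proof -
  obtain A B C :: "real^'d^'d" where ABC: "A \<in> SO" "B \<in> SO" "C \<in> SO"
    "\<And>x. A *v x + B *v x + C *v x = - x" using three_sign_matrices[OF d] by blast
  define \<gamma>' where "\<gamma>' = (\<lambda>i\<in>{1+1..4::nat}. if i = 2 then A else if i = 3 then B else C)"
  have \<gamma>': "\<gamma>' \<in> SO_tuples {1+1..4}" using ABC by (auto simp: \<gamma>'_def SO_tuples_def)
  have "merge {1..1} {1+1..4} (g, \<gamma>') \<in> dividing_tuples 4" if g: "g \<in> SO_tuples {1..1}" for g
  proof -
    define \<gamma> where "\<gamma> = merge {1..1} {1+1..4} (g, \<gamma>')"
    have vals: "\<gamma> 1 = g 1" "\<gamma> 2 = A" "\<gamma> 3 = B" "\<gamma> 4 = C"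
      by (simp_all add: \<gamma>_def merge_def \<gamma>'_def)
    have four: "{1..4::nat} = {1, 2, 3, 4}" by auto
    have g1: "g 1 \<in> SO" using g by (auto simp: SO_tuples_def)
    have "\<forall>i\<in>{1..4}. \<gamma> i \<in> SO" using g1 ABC vals unfolding four by simp
    moreover have "\<gamma> \<in> extensional {1..4}"
      by (simp add: \<gamma>_def merge_def extensional_def)
    ultimately have \<gamma>: "\<gamma> \<in> SO_tuples {1..4}" by (simp add: SO_tuples_def PiE_iff)
    obtain w where w: "w \<noteq> 0" "g 1 *v w = w" using odd_rotation_fixed_vector[OF d(2) g1] .
    have "(\<Sum>i=1..4. \<gamma> i *v w) = w + (A *v w + B *v w + C *v w)"
      unfolding four using vals w(2) by (simp add: add.assoc)
    then have "(\<Sum>i=1..4. \<gamma> i *v w) = 0" using ABC(4)[of w] by simp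
    moreover have "2 \<le> CARD('d)" using d by simp
    ultimately have "fractionally_divides 4 \<gamma>"
      using \<gamma> w(1) by (intro fractionally_divides_if_images_sum_zero[of 4 \<gamma> w])
        (auto simp: SO_tuples_def)
    then show ?thesis using \<gamma> by (simp add: dividing_tuples_def \<gamma>_def)
  qed
  then show ?thesis using \<gamma>' by (intro bexI[of _ \<gamma>']) (auto simp: dividing_section_def)
qed

theorem proposition1p3:
  shows "(CARD('d::finite) \<ge> 2 \<longrightarrow>
           (\<forall>r\<ge>2. f_top TYPE('d) r \<ge> 1 \<and> f_Haar TYPE('d) r \<ge> 1)) \<and>
         (CARD('d) \<ge> 3 \<and> odd (CARD('d)) \<longrightarrow>
           f_top TYPE('d) 4 \<ge> 2 \<and> f_Haar TYPE('d) 4 \<ge> 2)"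
proof (intro conjI impI allI)
  fix r :: nat assume "2 \<le> CARD('d)" "2 \<le> r"
  then have "\<And>l. l < 1 \<Longrightarrow> \<exists>\<gamma>'\<in>SO_tuples {l+1..r}.
      dividing_section r l \<gamma>' = (SO_tuples {1..l} :: (nat \<Rightarrow> real^'d^'d) set)"
    using roots_of_unity_section_full by simp
  from le_f_top_f_Haar[OF this] show "1 \<le> f_top TYPE('d) r" "1 \<le> f_Haar TYPE('d) r"
    by (simp_all add: one_enat_def)
next
  assume "3 \<le> CARD('d) \<and> odd CARD('d)"
  then have "\<exists>\<gamma>'\<in>SO_tuples {l+1..4}.
      dividing_section 4 l \<gamma>' = (SO_tuples {1..l} :: (nat \<Rightarrow> real^'d^'d) set)" if "l < 2" for l
    using roots_of_unity_section_full[of 4, where 'd='d] sign_matrices_section_full[where 'd='d] that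
    by (cases l) (auto simp: less_Suc_eq numeral_2_eq_2)
  from le_f_top_f_Haar[OF this] show "2 \<le> f_top TYPE('d) 4" "2 \<le> f_Haar TYPE('d) 4"
    by (simp_all add: numeral_eq_enat)
qed

end
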